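(* Let $\xi$ be an extremal number and let $G'$, $G''$ be its associated real quadratic forms. Then \[\nu(\xi)=\frac{\mu(G')}{\sqrt{\mathrm{disc}(G')}}=\frac{\mu(G'')}{\sqrt{\mathrm{disc}(G'')}}.\]
   Context: Let $\gamma=(1+\sqrt5)/2$. A real number $\xi$ is \emph{extremal} if it is neither rational nor quadratic over $\mathbb Q$ and there is a constant $c>0$ such that, for each real $X\ge 1$, the inequalities $|x_0|\le X$, $|x_0\xi-x_1|\le cX^{-1/\gamma}$, $|x_0\xi^2-x_2|\le cX^{-1/\gamma}$ admit a non-zero solution $(x_0,x_1,x_2)\in\mathbb Z^3$. The Lagrange constant of $\xi\in\mathbb R$ is $\nu(\xi)=\liminf_{q\to\infty}q\|q\xi\|$, where $\|x\|$ is the distance from the real number $x$ to a closest integer. For a real binary quadratic form $F(U,T)=rU^2+qUT+sT^2$, $\mathrm{disc}(F)=q^2-4rs$ and $\mu(F)=\inf\{|F(x,y)|\,;\,(x,y)\in\mathbb Z^2,\ (x,y)\ne(0,0)\}$. Let $\mathcal P$ be the set of $2\times2$ integer matrices with non-zero determinant and relatively prime coefficients; it is a group under $\mathbf y_1*\mathbf y_2=c^{-1}\mathbf y_1\mathbf y_2$, where $c$ is the greatest positive common divisor of the coefficients of $\mathbf y_1\mathbf y_2$. The norm of a real matrix or vector is the largest absolute value of its coefficients. It is known that for each extremal $\xi$ there is an unbounded sequence $(\mathbf x_i)_{i\ge1}$ of symmetric matrices in $\mathcal P$ with $\|\mathbf x_{i+1}\|\asymp\|\mathbf x_i\|^\gamma$,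 $\|(\xi,-1)\mathbf x_i\|\asymp\|\mathbf x_i\|^{-1}$ and $|\det\mathbf x_i|\asymp1$ (implied constants independent of $i$), and a matrix $M=\begin{pmatrix}a&b\\c&d\end{pmatrix}\in\mathcal P$, neither symmetric nor skew-symmetric, such that, for each sufficiently large $i$, $\mathbf x_{i+2}=\pm\,\mathbf x_{i+1}*M*\mathbf x_i$ if $i$ is odd and $\mathbf x_{i+2}=\pm\,\mathbf x_{i+1}*{}^tM*\mathbf x_i$ if $i$ is even; moreover $M$ is uniquely determined by $\xi$ within the set $\{\pm M,\pm{}^tM\}$. The \emph{conjugates} of $\xi$ are $\xi'=-\frac{a+b\xi}{c+d\xi}$ and $\xi''=-\frac{a+c\xi}{b+d\xi}$, and the \emph{real quadratic forms associated to} $\xi$ are $G'(U,T)=(c+d\xi)(T-\xi U)(T-\xi'U)$ and $G''(U,T)=(b+d\xi)(T-\xi U)(T-\xi''U)$. The sets $\{\xi',\xi''\}$ and $\{\pm G',\pm G''\}$ depend only on $\xi$. *)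

theory Defs
  imports "HOL-Analysis.Analysis"
begin

definition golden :: real where
  "golden = (1 + sqrt 5) / 2"

definition quadratic_irrational :: "real \<Rightarrow> bool" where
  "quadratic_irrational \<xi> \<longleftrightarrow>
     \<xi> \<notin> \<rat> \<and> (\<exists>a\<in>\<rat>. \<exists>b\<in>\<rat>. \<exists>c\<in>\<rat>. a \<noteq> 0 \<and> a * \<xi>\<^sup>2 + b * \<xi> + c = 0)"

definition extremal :: "real \<Rightarrow> bool" where
  "extremal \<xi> \<longleftrightarrow>
     \<xi> \<notin> \<rat> \<and> \<not> quadratic_irrational \<xi> \<and>
     (\<exists>c>0. \<forall>X\<ge>1. \<exists>x0 x1 x2 :: int. (x0, x1, x2) \<noteq> (0, 0, 0) \<and>
        \<bar>of_int x0\<bar> \<le> X \<and>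
        \<bar>of_int x0 * \<xi> - of_int x1\<bar> \<le> c * X powr (- 1 / golden) \<and>
        \<bar>of_int x0 * \<xi>\<^sup>2 - of_int x2\<bar> \<le> c * X powr (- 1 / golden))"

text \<open>The value is an \<^typ>\<open>ereal\<close> because \<^const>\<open>liminf\<close> requires a complete lattice.\<close>

definition lagrange_const :: "real \<Rightarrow> ereal" where
  "lagrange_const \<xi> = liminf (\<lambda>q::nat. ereal (real q * infdist (real q * \<xi>) \<int>))"

text \<open>\<open>BQF r q s\<close> stands for $r U^2 + q U T + s T^2$.\<close>

datatype bqf = BQF real real real

fun bqf_eval :: "bqf \<Rightarrow> real \<Rightarrow> real \<Rightarrow> real" where
  "bqf_eval (BQF r q s) u t = r * u\<^sup>2 + q * u * t + s * t\<^sup>2"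

fun bqf_disc :: "bqf \<Rightarrow> real" where
  "bqf_disc (BQF r q s) = q\<^sup>2 - 4 * r * s"

definition bqf_min :: "bqf \<Rightarrow> real" where
  "bqf_min F = Inf {\<bar>bqf_eval F (of_int x) (of_int y)\<bar> | x y :: int. (x, y) \<noteq> (0, 0)}"

text \<open>The form $k (T - \alpha U)(T - \beta U)$; see \<open>bqf_eval_factored\<close>.\<close>

definition bqf_factored :: "real \<Rightarrow> real \<Rightarrow> real \<Rightarrow> bqf" where
  "bqf_factored k \<alpha> \<beta> = BQF (k * \<alpha> * \<beta>) (- k * (\<alpha> + \<beta>)) k"

lemma bqf_eval_factored:
  "bqf_eval (bqf_factored k \<alpha> \<beta>) u t = k * (t - \<alpha> * u) * (t - \<beta> * u)"
  by (simp add: bqf_factored_def algebra_simps power2_eq_square)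

definition mat_content :: "int^2^2 \<Rightarrow> int" where
  "mat_content A = Gcd {A $ i $ j | i j. True}"

definition prim_mats :: "(int^2^2) set" where
  "prim_mats = {A. det A \<noteq> 0 \<and> mat_content A = 1}"

definition prim_mult :: "int^2^2 \<Rightarrow> int^2^2 \<Rightarrow> int^2^2"  (infixl "\<star>" 70) where
  "A \<star> B = map_matrix (\<lambda>e. e div mat_content (A ** B)) (A ** B)"

abbreviation real_mat :: "int^2^2 \<Rightarrow> real^2^2" where
  "real_mat \<equiv> map_matrix real_of_int"

text \<open>The norm of a real matrix or vector used below is the library's \<^const>\<open>infnorm\<close>,
  the largest absolute value of the coefficients with respect to the standard basis.\<close>

lemma infnorm_matrix:
  fixes A :: "real^'n^'m"
  shows "infnorm A = Max {\<bar>A $ i $ j\<bar> | i j. True}"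
proof -
  have "infnorm A = Max ((\<lambda>b. \<bar>A \<bullet> b\<bar>) ` Basis)"
    by (rule infnorm_Max)
  also have "(\<lambda>b. \<bar>A \<bullet> b\<bar>) ` Basis = {\<bar>A $ i $ j\<bar> | i j. True}"
    by (force simp: Basis_vec_def inner_axis)
  finally show ?thesis .
qed

text \<open>\<open>f \<asymp> g\<close> with constants independent of the index \<open>i \<ge> 1\<close>.\<close>

definition comparable :: "(nat \<Rightarrow> real) \<Rightarrow> (nat \<Rightarrow> real) \<Rightarrow> bool" where
  "comparable f g \<longleftrightarrow> (\<exists>c1>0. \<exists>c2>0. \<forall>i\<ge>1. c1 * g i \<le> f i \<and> f i \<le> c2 * g i)"

text \<open>Sequences are indexed by \<open>i \<ge> 1\<close>; the value at \<open>0\<close> is irrelevant.\<close>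

definition approximating_sequence :: "real \<Rightarrow> (nat \<Rightarrow> int^2^2) \<Rightarrow> bool" where
  "approximating_sequence \<xi> x \<longleftrightarrow>
     (\<forall>i\<ge>1. x i \<in> prim_mats \<and> transpose (x i) = x i) \<and>
     \<not> bdd_above ((\<lambda>i. infnorm (real_mat (x i))) ` {1..}) \<and>
     comparable (\<lambda>i. infnorm (real_mat (x (i + 1)))) (\<lambda>i. infnorm (real_mat (x i)) powr golden) \<and>
     comparable (\<lambda>i. infnorm (vector [\<xi>, -1] v* real_mat (x i)))
                (\<lambda>i. inverse (infnorm (real_mat (x i)))) \<and>
     comparable (\<lambda>i. \<bar>real_of_int (det (x i))\<bar>) (\<lambda>i. 1)"

text \<open>For an extremal \<open>\<xi>\<close> such a matrix exists and is unique up to sign and transposition.\<close>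

definition associated_matrix :: "real \<Rightarrow> int^2^2 \<Rightarrow> bool" where
  "associated_matrix \<xi> M \<longleftrightarrow>
     M \<in> prim_mats \<and> transpose M \<noteq> M \<and> transpose M \<noteq> - M \<and>
     (\<exists>x. approximating_sequence \<xi> x \<and>
        (\<forall>\<^sub>F i in sequentially.
           (odd i \<longrightarrow> x (i + 2) \<in> {x (i + 1) \<star> M \<star> x i, - (x (i + 1) \<star> M \<star> x i)}) \<and>
           (even i \<longrightarrow> x (i + 2) \<in> {x (i + 1) \<star> transpose M \<star> x i,
                                      - (x (i + 1) \<star> transpose M \<star> x i)})))"

definition conj1 :: "real \<Rightarrow> int^2^2 \<Rightarrow> real" where
  "conj1 \<xi> M = - (of_int (M$1$1) + of_int (M$1$2) * \<xi>) / (of_int (M$2$1) + of_int (M$2$2) * \<xi>)"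

definition conj2 :: "real \<Rightarrow> int^2^2 \<Rightarrow> real" where
  "conj2 \<xi> M = - (of_int (M$1$1) + of_int (M$2$1) * \<xi>) / (of_int (M$1$2) + of_int (M$2$2) * \<xi>)"

definition assoc_form1 :: "real \<Rightarrow> int^2^2 \<Rightarrow> bqf" where
  "assoc_form1 \<xi> M = bqf_factored (of_int (M$2$1) + of_int (M$2$2) * \<xi>) \<xi> (conj1 \<xi> M)"

definition assoc_form2 :: "real \<Rightarrow> int^2^2 \<Rightarrow> bqf" where
  "assoc_form2 \<xi> M = bqf_factored (of_int (M$1$2) + of_int (M$2$2) * \<xi>) \<xi> (conj2 \<xi> M)"

end

theory Submission
  imports Defs
begin

text \<open>
  Fix an integer matrix \<open>N\<close>, which is either \<open>M\<close> or its transpose, and write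
  \<open>\<alpha> = N\<^sub>1\<^sub>1 + N\<^sub>1\<^sub>2 \<xi>\<close>, \<open>\<beta> = N\<^sub>2\<^sub>1 + N\<^sub>2\<^sub>2 \<xi>\<close>, \<open>\<theta> = \<alpha> + \<beta> \<xi>\<close>. The form attached to \<open>N\<close> is
  \<open>G(u, t) = (t - \<xi> u) (\<alpha> u + \<beta> t)\<close>; its discriminant is \<open>\<theta>\<^sup>2\<close>, and \<open>\<theta> \<noteq> 0\<close> because \<open>\<xi>\<close> is neither
  rational nor quadratic and \<open>N\<close> is not skew-symmetric. So the claim is \<open>\<nu>(\<xi>) = \<mu>(G) / \<bar>\<theta>\<bar>\<close>.

  The inequality \<open>\<ge>\<close> holds because \<open>\<xi>\<close> is a root of \<open>G\<close>: if \<open>p / q\<close> is close to \<open>\<xi>\<close>, then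
  \<open>\<alpha> q + \<beta> p \<approx> \<theta> q\<close>, whence \<open>\<bar>G(q, p)\<bar> \<approx> \<bar>\<theta>\<bar> q \<bar>q \<xi> - p\<bar>\<close> (\<open>lagrange_const_geI\<close>).

  For \<open>\<le>\<close>, every value \<open>\<bar>G(u)\<bar> / \<bar>\<theta>\<bar>\<close> with \<open>u \<in> \<int>\<^sup>2\<close> non-zero has to be a limit of products
  \<open>\<bar>p\<^sub>0 (p\<^sub>1 - \<xi> p\<^sub>0)\<bar>\<close> with \<open>p \<in> \<int>\<^sup>2\<close> and \<open>\<bar>p\<^sub>0\<bar> \<rightarrow> \<infinity>\<close>. The determinants of the symmetric matrices
  \<open>x\<^sub>j\<close> are bounded, so infinitely many indices \<open>j\<close> of the parity that goes with \<open>N\<close> have the same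
  determinant \<open>D\<close> and the same \<open>x\<^sub>j\<close> modulo \<open>D\<close> (\<open>residue_class_subsequence\<close>). For two such indices
  the matrix \<open>x\<^sub>j x\<^sub>i\<^sup>-\<^sup>1\<close> is integral, and one takes \<open>p = x\<^sub>j x\<^sub>i\<^sup>-\<^sup>1 u\<close>. Let \<open>\<delta>\<^sub>j = (\<xi>, -1) x\<^sub>j\<close> and let \<open>h\<^sub>j\<close> be
  the upper left coefficient of \<open>x\<^sub>j\<close>. Then \<open>h\<^sub>j \<delta>\<^sub>j \<rightarrow> (D / \<theta>) (\<beta>, -\<alpha>)\<close>: the determinant controls
  the product of \<open>h\<^sub>j \<delta>\<^sub>j\<close> with the column \<open>(\<xi>, -1)\<close>, and the recurrence
  \<open>x\<^sub>j N x\<^sub>j\<^sub>-\<^sub>1 \<propto> x\<^sub>j\<^sub>+\<^sub>1\<close> shows that the product of \<open>h\<^sub>j \<delta>\<^sub>j\<close> with the column \<open>(\<alpha>, \<beta>)\<close> tends to \<open>0\<close>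
  (\<open>defect_orthogonality\<close>, \<open>scaled_defect_limits\<close>). Letting first \<open>j\<close> and then \<open>i\<close> tend to infinity,
  \<open>p\<^sub>0 (p\<^sub>1 - \<xi> p\<^sub>0)\<close> tends to \<open>G(u) / \<theta>\<close> (\<open>form_values_attained\<close>).
\<close>

section \<open>Integer matrices and their norms\<close>

text \<open>The entries of the row vector \<open>(\<xi>, -1) A\<close>, which measures how far the columns of \<open>A\<close> are from
  the line spanned by \<open>(1, \<xi>)\<close>.\<close>

definition defect :: "real \<Rightarrow> int^2^2 \<Rightarrow> 2 \<Rightarrow> real" where
  "defect \<xi> A a = \<xi> * of_int (A$1$a) - of_int (A$2$a)"

lemma defect_eq_vector_mult:
  "defect \<xi> A a = (vector [\<xi>, -1] v* real_mat A) $ a"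
  by (simp add: defect_def vector_matrix_mult_def map_matrix_def sum_2 mult.commute)

lemma abs_defect_le: "\<bar>defect \<xi> A a\<bar> \<le> infnorm (vector [\<xi>, -1] v* real_mat A)"
  unfolding defect_eq_vector_mult by (rule component_le_infnorm_cart)

lemma abs_entry_le_infnorm: "\<bar>real_of_int (A$a$b)\<bar> \<le> infnorm (real_mat A)"
proof -
  have fin: "finite {\<bar>real_mat A $ i $ j\<bar> | i j. True}"
    using finite_imageI[of "UNIV :: (2 \<times> 2) set" "\<lambda>(i, j). \<bar>real_mat A $ i $ j\<bar>"]
    by (rule finite_subset[rotated]) auto
  have "\<bar>real_mat A $ a $ b\<bar> \<le> infnorm (real_mat A)"
    unfolding infnorm_matrix by (rule Max_ge[OF fin]) blast
  then show ?thesis by (simp add: map_matrix_def)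
qed

lemma infnorm_le_sum_entries:
  "infnorm (real_mat A) \<le> \<bar>real_of_int (A$1$1)\<bar> + \<bar>real_of_int (A$1$2)\<bar>
     + \<bar>real_of_int (A$2$1)\<bar> + \<bar>real_of_int (A$2$2)\<bar>"
proof -
  let ?S = "{\<bar>real_mat A $ i $ j\<bar> | i j. True}"
  have fin: "finite ?S"
    using finite_imageI[of "UNIV :: (2 \<times> 2) set" "\<lambda>(i, j). \<bar>real_mat A $ i $ j\<bar>"]
    by (rule finite_subset[rotated]) auto
  have "infnorm (real_mat A) \<in> ?S"
    unfolding infnorm_matrix by (rule Max_in[OF fin]) blast
  then obtain i j where "infnorm (real_mat A) = \<bar>real_mat A $ i $ j\<bar>" by blast
  then show ?thesis
    using exhaust_2[of i] exhaust_2[of j] by (auto simp: map_matrix_def)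
qed

lemma one_le_infnorm:
  assumes "det A \<noteq> 0"
  shows "1 \<le> infnorm (real_mat A)"
proof -
  have "A$1$1 \<noteq> 0 \<or> A$1$2 \<noteq> 0"
    using assms by (auto simp: det_2)
  then obtain b where "A$1$b \<noteq> 0" by blast
  then have "1 \<le> \<bar>real_of_int (A$1$b)\<bar>"
    by linarith
  then show ?thesis using abs_entry_le_infnorm[of A 1 b] by linarith
qed

section \<open>The recurrence for the approximating matrices\<close>

lemma prim_mult_dividend:
  obtains c :: int where "\<And>i j. (A ** B)$i$j = c * (A \<star> B)$i$j"
proof
  fix i j
  have "mat_content (A ** B) dvd (A ** B)$i$j"
    unfolding mat_content_def by (rule Gcd_dvd) blast
  then show "(A ** B)$i$j = mat_content (A ** B) * (A \<star> B)$i$j"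
    by (simp add: prim_mult_def map_matrix_def)
qed

lemma prim_mult_triple_dividend:
  assumes "Y \<in> {A \<star> N \<star> B, - (A \<star> N \<star> B)}"
  obtains c :: int where "\<And>i j. (A ** N ** B)$i$j = c * Y$i$j"
proof -
  obtain c1 where c1: "\<And>i j. (A ** N)$i$j = c1 * (A \<star> N)$i$j"
    using prim_mult_dividend by blast
  obtain c2 where c2: "\<And>i j. ((A \<star> N) ** B)$i$j = c2 * (A \<star> N \<star> B)$i$j"
    using prim_mult_dividend by blast
  have *: "(A ** N ** B)$i$j = c1 * c2 * (A \<star> N \<star> B)$i$j" for i j
  proof -
    have "(A ** N ** B)$i$j = c1 * ((A \<star> N) ** B)$i$j"
      using c1 by (simp add: matrix_matrix_mult_def sum_distrib_left mult.assoc)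
    then show ?thesis by (simp add: c2)
  qed
  show thesis
  proof (cases "Y = A \<star> N \<star> B")
    case True
    then show thesis using * that by blast
  next
    case False
    then have "Y = - (A \<star> N \<star> B)" using assms by blast
    then have "(A ** N ** B)$i$j = - (c1 * c2) * Y$i$j" for i j
      using * by simp
    then show thesis using that by blast
  qed
qed

text \<open>The identity compares the first entries of \<open>(\<xi>, -1) A N B\<close> and \<open>c (\<xi>, -1) Y\<close>, after the first
  column of \<open>B\<close> has been split as \<open>B\<^sub>1\<^sub>1 (1, \<xi>)\<close> minus a vector supported on the second entry, which
  is the defect of that column.\<close>

lemma defect_recurrence:
  fixes \<xi> :: real
  assumes "\<And>i j. (A ** N ** B)$i$j = c * Y$i$j"
  shows "of_int (B$1$1) * (defect \<xi> A 1 * (N$1$1 + N$1$2 * \<xi>) + defect \<xi> A 2 * (N$2$1 + N$2$2 * \<xi>))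
       = c * defect \<xi> Y 1 + defect \<xi> B 1 * (defect \<xi> A 1 * N$1$2 + defect \<xi> A 2 * N$2$2)"
proof -
  have "real_of_int c * defect \<xi> Y 1 = \<xi> * of_int (c * Y$1$1) - of_int (c * Y$2$1)"
    by (simp add: defect_def algebra_simps)
  also have "\<dots> = \<xi> * of_int ((A ** N ** B)$1$1) - of_int ((A ** N ** B)$2$1)"
    using assms by simp
  also have "\<dots> = defect \<xi> A 1 * (N$1$1 * B$1$1 + N$1$2 * B$2$1)
                + defect \<xi> A 2 * (N$2$1 * B$1$1 + N$2$2 * B$2$1)"
    by (simp add: matrix_matrix_mult_def sum_2 defect_def algebra_simps)
  finally show ?thesis
    by (simp add: defect_def algebra_simps)
qed

lemma det_symmetric_defect:
  fixes \<xi> :: real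
  assumes "A$2$1 = A$1$2"
  shows "real_of_int (det A) = A$1$1 * (\<xi> * defect \<xi> A 1 - defect \<xi> A 2) - (defect \<xi> A 1)\<^sup>2"
  by (simp add: det_2 defect_def assms algebra_simps power2_eq_square)

section \<open>Asymptotic behaviour of an approximating sequence\<close>

text \<open>A single constant for all the bounds that are needed. Of the growth condition
  \<open>\<parallel>x\<^sub>i\<^sub>+\<^sub>1\<parallel> \<asymp> \<parallel>x\<^sub>i\<parallel>\<^sup>\<gamma>\<close> only two consequences matter: \<open>\<parallel>x\<^sub>i\<parallel>\<close> is bounded by a multiple of \<open>\<parallel>x\<^sub>i\<^sub>+\<^sub>1\<parallel>\<close>, and
  the norms, being unbounded, tend to infinity.\<close>

lemma approximating_sequence_bounds:
  assumes "approximating_sequence \<xi> x"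
  obtains C where "C > 0"
    and "\<And>i. i \<ge> 1 \<Longrightarrow> det (x i) \<noteq> 0"
    and "\<And>i. i \<ge> 1 \<Longrightarrow> transpose (x i) = x i"
    and "\<And>i. i \<ge> 1 \<Longrightarrow> \<bar>real_of_int (det (x i))\<bar> \<le> C"
    and "\<And>i a. i \<ge> 1 \<Longrightarrow> \<bar>defect \<xi> (x i) a\<bar> \<le> C / infnorm (real_mat (x i))"
    and "\<And>i. i \<ge> 1 \<Longrightarrow> infnorm (real_mat (x i)) \<le> C * infnorm (real_mat (x (i + 1)))"
    and "filterlim (\<lambda>i. infnorm (real_mat (x i))) at_top sequentially"
proof -
  let ?X = "\<lambda>i. infnorm (real_mat (x i))"
  note A = assms[unfolded approximating_sequence_def comparable_def]
  note A1 = conjunct1[OF A] and A2 = conjunct1[OF conjunct2[OF A]]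
    and A3 = conjunct1[OF conjunct2[OF conjunct2[OF A]]]
    and A4 = conjunct1[OF conjunct2[OF conjunct2[OF conjunct2[OF A]]]]
    and A5 = conjunct2[OF conjunct2[OF conjunct2[OF conjunct2[OF A]]]]
  from A1 have sym: "transpose (x i) = x i" and det: "det (x i) \<noteq> 0" if "i \<ge> 1" for i
    using that by (auto simp: prim_mats_def)
  have X1: "?X i \<ge> 1" if "i \<ge> 1" for i
    using one_le_infnorm det that by blast
  from A3 obtain c1 where c1: "c1 > 0" "\<And>i. i \<ge> 1 \<Longrightarrow> c1 * ?X i powr golden \<le> ?X (i + 1)"
    by blast
  from A4 obtain c2 where c2: "c2 > 0"
      "\<And>i. i \<ge> 1 \<Longrightarrow> infnorm (vector [\<xi>, -1] v* real_mat (x i)) \<le> c2 * inverse (?X i)"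
    by blast
  from A5 obtain c3 where c3: "c3 > 0" "\<And>i. i \<ge> 1 \<Longrightarrow> \<bar>real_of_int (det (x i))\<bar> \<le> c3 * 1"
    by blast
  have golden: "golden > 1"
    unfolding golden_def using real_less_rsqrt[of 1 5] by simp
  define C where "C = c2 + c3 + 1 / c1"
  have C: "C > 0" "c2 \<le> C" "c3 \<le> C" "1 / c1 \<le> C"
    using c1(1) c2(1) c3(1) by (auto simp: C_def add_pos_pos)
  have step: "?X i \<le> C * ?X (i + 1)" if "i \<ge> 1" for i
  proof -
    have "?X i powr 1 \<le> ?X i powr golden"
      using X1[OF that] golden by (intro powr_mono) auto
    then have "?X i \<le> ?X i powr golden" using X1[OF that] by simp
    then have "c1 * ?X i \<le> ?X (i + 1)"
      using c1(2)[OF that] mult_left_mono[of "?X i" "?X i powr golden" c1] c1(1) by linarith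
    then have "?X i \<le> 1 / c1 * ?X (i + 1)"
      using c1(1) by (simp add: field_simps)
    also have "\<dots> \<le> C * ?X (i + 1)"
      using C(4) X1[of "i + 1"] by (intro mult_right_mono) auto
    finally show ?thesis .
  qed
  have lim: "filterlim ?X at_top sequentially"
  proof -
    \<comment> \<open>As \<open>\<gamma> > 1\<close>, the norms at least double at each step as soon as one of them reaches \<open>R\<close>.\<close>
    define R where "R = (2 / c1) powr (1 / (golden - 1)) + 1"
    have R: "R \<ge> 1" by (simp add: R_def)
    have double: "?X (i + 1) \<ge> 2 * ?X i" if "i \<ge> 1" "?X i \<ge> R" for i
    proof -
      have "2 / c1 = ((2 / c1) powr (1 / (golden - 1))) powr (golden - 1)"
        using golden c1(1) by (simp add: powr_powr)
      also have "\<dots> \<le> ?X i powr (golden - 1)"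
        using golden that(2) by (intro powr_mono2) (auto simp: R_def)
      finally have "2 \<le> c1 * ?X i powr (golden - 1)"
        using c1(1) by (simp add: field_simps)
      then have "2 * ?X i \<le> c1 * ?X i powr (golden - 1) * ?X i"
        using X1[OF that(1)] by (intro mult_right_mono) auto
      also have "\<dots> = c1 * ?X i powr golden"
        using X1[OF that(1)] by (simp add: powr_diff)
      finally show ?thesis using c1(2)[OF that(1)] by linarith
    qed
    have "\<exists>i0\<ge>1. R \<le> ?X i0"
    proof (rule ccontr)
      assume "\<not> ?thesis"
      then have "?X i \<le> R" if "i \<in> {1..}" for i using that by (meson atLeast_iff linear)
      then have "bdd_above (?X ` {1..})" by (rule bdd_aboveI2)
      then show False using A2 by contradiction
    qed
    then obtain i0 where i0: "i0 \<ge> 1" "?X i0 \<ge> R" by blast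
    have grow: "?X (i0 + n) \<ge> R * 2 ^ n" for n
    proof (induction n)
      case 0
      then show ?case using i0 by simp
    next
      case (Suc n)
      have "R \<le> R * 2 ^ n" using R by simp
      then have "?X (i0 + n) \<ge> R" using Suc by linarith
      then show ?case using double[of "i0 + n"] Suc i0 by simp
    qed
    have "?X (i0 + n) \<ge> real n" for n
    proof -
      have "real n \<le> 2 ^ n" by (simp add: less_imp_le of_nat_less_two_power)
      also have "\<dots> \<le> R * 2 ^ n" using R by simp
      finally show ?thesis using grow[of n] by linarith
    qed
    then have "filterlim (\<lambda>n. ?X (i0 + n)) at_top sequentially"
      by (intro filterlim_at_top_mono[OF filterlim_real_sequentially]) auto
    then show ?thesis
      unfolding filterlim_at_top
      using eventually_sequentially_seg[of "\<lambda>n. _ \<le> ?X n" i0] by (simp add: add.commute)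
  qed
  show thesis
  proof (rule that[OF C(1) det sym _ _ step lim])
    fix i :: nat assume i: "i \<ge> 1"
    show "\<bar>real_of_int (det (x i))\<bar> \<le> C" using c3(2)[OF i] C(3) by simp
    fix a
    have "\<bar>defect \<xi> (x i) a\<bar> \<le> c2 / ?X i"
      using abs_defect_le[of \<xi> "x i" a] c2(2)[OF i] by (simp add: divide_inverse)
    also have "\<dots> \<le> C / ?X i" using C X1[OF i] by (intro divide_right_mono) auto
    finally show "\<bar>defect \<xi> (x i) a\<bar> \<le> C / ?X i" .
  qed auto
qed

lemma infnorm_le_corner:
  fixes \<xi> :: real
  assumes "A$2$1 = A$1$2"
  shows "infnorm (real_mat A) \<le> (1 + \<bar>\<xi>\<bar>)\<^sup>2 * \<bar>A$1$1\<bar>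
          + (2 + \<bar>\<xi>\<bar>) * \<bar>defect \<xi> A 1\<bar> + \<bar>defect \<xi> A 2\<bar>"
proof -
  have e12: "real_of_int (A$1$2) = \<xi> * A$1$1 - defect \<xi> A 1"
    by (simp add: defect_def assms)
  have e22: "real_of_int (A$2$2) = \<xi> * \<xi> * A$1$1 - \<xi> * defect \<xi> A 1 - defect \<xi> A 2"
    by (simp add: defect_def assms algebra_simps)
  have "\<bar>real_of_int (A$1$2)\<bar> \<le> \<bar>\<xi>\<bar> * \<bar>A$1$1\<bar> + \<bar>defect \<xi> A 1\<bar>"
    unfolding e12 using abs_triangle_ineq4[of "\<xi> * A$1$1" "defect \<xi> A 1"]
    by (simp add: abs_mult)
  moreover have "\<bar>real_of_int (A$2$2)\<bar> \<le> \<bar>\<xi>\<bar> * \<bar>\<xi>\<bar> * \<bar>A$1$1\<bar> + \<bar>\<xi>\<bar> * \<bar>defect \<xi> A 1\<bar> + \<bar>defect \<xi> A 2\<bar>"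
    unfolding e22
    using abs_triangle_ineq4[of "\<xi> * \<xi> * A$1$1 - \<xi> * defect \<xi> A 1" "defect \<xi> A 2"]
      abs_triangle_ineq4[of "\<xi> * \<xi> * A$1$1" "\<xi> * defect \<xi> A 1"]
    by (simp add: abs_mult)
  ultimately show ?thesis
    using infnorm_le_sum_entries[of A] assms
    by (simp add: algebra_simps power2_eq_square)
qed


lemma defect_tendsto_0:
  assumes "approximating_sequence \<xi> x"
  shows "(\<lambda>i. defect \<xi> (x i) a) \<longlonglongrightarrow> 0"
proof -
  obtain C where defect: "\<And>i a. i \<ge> 1 \<Longrightarrow> \<bar>defect \<xi> (x i) a\<bar> \<le> C / infnorm (real_mat (x i))"
    and lim: "filterlim (\<lambda>i. infnorm (real_mat (x i))) at_top sequentially"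
    by (rule approximating_sequence_bounds[OF assms]) blast
  have "(\<lambda>i. C / infnorm (real_mat (x i))) \<longlonglongrightarrow> 0"
    by (rule tendsto_divide_0[OF tendsto_const filterlim_at_top_imp_at_infinity[OF lim]])
  then show ?thesis
    by (rule Lim_null_comparison[rotated]) (use defect in \<open>auto simp: eventually_sequentially\<close>)
qed

lemma filterlim_corner:
  assumes "approximating_sequence \<xi> x"
  shows "filterlim (\<lambda>i. \<bar>real_of_int (x i$1$1)\<bar>) at_top sequentially"
proof -
  obtain C where C: "C > 0"
    and det: "\<And>i. i \<ge> 1 \<Longrightarrow> det (x i) \<noteq> 0"
    and sym: "\<And>i. i \<ge> 1 \<Longrightarrow> transpose (x i) = x i"
    and defect: "\<And>i a. i \<ge> 1 \<Longrightarrow> \<bar>defect \<xi> (x i) a\<bar> \<le> C / infnorm (real_mat (x i))"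
    and lim: "filterlim (\<lambda>i. infnorm (real_mat (x i))) at_top sequentially"
    by (rule approximating_sequence_bounds[OF assms]) blast
  let ?X = "\<lambda>i. infnorm (real_mat (x i))"
  have bound: "?X i \<le> (1 + \<bar>\<xi>\<bar>)\<^sup>2 * \<bar>x i$1$1\<bar> + (3 + \<bar>\<xi>\<bar>) * C" if i: "i \<ge> 1" for i
  proof -
    have "x i$2$1 = x i$1$2" using sym[OF i] by (simp add: transpose_def vec_eq_iff)
    then have le: "?X i \<le> (1 + \<bar>\<xi>\<bar>)\<^sup>2 * \<bar>x i$1$1\<bar>
          + (2 + \<bar>\<xi>\<bar>) * \<bar>defect \<xi> (x i) 1\<bar> + \<bar>defect \<xi> (x i) 2\<bar>"
      by (rule infnorm_le_corner)
    have "C / ?X i \<le> C / 1"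
      using C one_le_infnorm[OF det[OF i]] by (intro divide_left_mono) auto
    then have d: "\<bar>defect \<xi> (x i) a\<bar> \<le> C" for a using defect[OF i, of a] by simp
    have "(2 + \<bar>\<xi>\<bar>) * \<bar>defect \<xi> (x i) 1\<bar> \<le> (2 + \<bar>\<xi>\<bar>) * C"
      by (intro mult_left_mono d) auto
    then show ?thesis using le d[of 2] by (simp add: algebra_simps)
  qed
  have pos: "(1 + \<bar>\<xi>\<bar>)\<^sup>2 > 0"
    by (simp add: add_pos_nonneg)
  have "filterlim (\<lambda>i. - ((3 + \<bar>\<xi>\<bar>) * C) + ?X i) at_top sequentially"
    by (rule filterlim_tendsto_add_at_top[OF tendsto_const lim])
  then have "filterlim (\<lambda>i. inverse ((1 + \<bar>\<xi>\<bar>)\<^sup>2) * (- ((3 + \<bar>\<xi>\<bar>) * C) + ?X i)) at_top sequentially"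
    using pos by (intro filterlim_tendsto_pos_mult_at_top[OF tendsto_const]) auto
  then show ?thesis
  proof (rule filterlim_at_top_mono)
    show "\<forall>\<^sub>F i in sequentially. inverse ((1 + \<bar>\<xi>\<bar>)\<^sup>2) * (- ((3 + \<bar>\<xi>\<bar>) * C) + ?X i) \<le> \<bar>real_of_int (x i$1$1)\<bar>"
    proof (rule eventually_sequentiallyI[of 1])
      fix i :: nat assume "1 \<le> i"
      then have "?X i - (3 + \<bar>\<xi>\<bar>) * C \<le> (1 + \<bar>\<xi>\<bar>)\<^sup>2 * \<bar>x i$1$1\<bar>" using bound by fastforce
      then have "(?X i - (3 + \<bar>\<xi>\<bar>) * C) / (1 + \<bar>\<xi>\<bar>)\<^sup>2 \<le> \<bar>x i$1$1\<bar>"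
        using pos by (simp add: divide_le_eq mult.commute)
      then show "inverse ((1 + \<bar>\<xi>\<bar>)\<^sup>2) * (- ((3 + \<bar>\<xi>\<bar>) * C) + ?X i) \<le> \<bar>real_of_int (x i$1$1)\<bar>"
        by (simp add: divide_inverse mult.commute)
    qed
  qed
qed

text \<open>The vector \<open>(\<xi>, -1) x\<^sub>j N\<close> becomes almost orthogonal to \<open>(1, \<xi>)\<close>, to a precision
  \<open>o(1 / \<parallel>x\<^sub>j\<parallel>)\<close> that is better than its size \<open>1 / \<parallel>x\<^sub>j\<parallel>\<close>.\<close>

lemma defect_orthogonality:
  fixes \<xi> :: real and s :: "nat \<Rightarrow> nat" and N :: "int^2^2"
  assumes x: "approximating_sequence \<xi> x" and s: "strict_mono s"
    and rec: "\<And>k. x (s k + 1) \<in> {x (s k) \<star> N \<star> x (s k - 1), - (x (s k) \<star> N \<star> x (s k - 1))}"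
  shows "(\<lambda>k. x (s k)$1$1 * (defect \<xi> (x (s k)) 1 * (N$1$1 + N$1$2 * \<xi>)
                          + defect \<xi> (x (s k)) 2 * (N$2$1 + N$2$2 * \<xi>))) \<longlonglongrightarrow> 0"
    (is "?T \<longlonglongrightarrow> 0")
proof -
  obtain C where C: "C > 0"
    and det: "\<And>i. i \<ge> 1 \<Longrightarrow> det (x i) \<noteq> 0"
    and sym: "\<And>i. i \<ge> 1 \<Longrightarrow> transpose (x i) = x i"
    and detC: "\<And>i. i \<ge> 1 \<Longrightarrow> \<bar>real_of_int (det (x i))\<bar> \<le> C"
    and defect: "\<And>i a. i \<ge> 1 \<Longrightarrow> \<bar>defect \<xi> (x i) a\<bar> \<le> C / infnorm (real_mat (x i))"
    and step: "\<And>i. i \<ge> 1 \<Longrightarrow> infnorm (real_mat (x i)) \<le> C * infnorm (real_mat (x (i + 1)))"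
    by (rule approximating_sequence_bounds[OF x]) blast
  let ?X = "\<lambda>i. infnorm (real_mat (x i))"
  define n where "n = \<bar>real_of_int (N$1$2)\<bar> + \<bar>real_of_int (N$2$2)\<bar>"
  define E where "E = C\<^sup>2 * \<bar>real_of_int (det N)\<bar> * C\<^sup>2 + C\<^sup>2 * n"
  have bound: "\<bar>?T k\<bar> * \<bar>real_of_int (x (s k - 1)$1$1)\<bar> \<le> E" if k: "k \<ge> 2" for k
  proof -
    define j where "j = s k"
    have j: "j \<ge> 1" "j - 1 \<ge> 1" using k strict_mono_imp_increasing[OF s, of k] by (auto simp: j_def)
    obtain c where c: "\<And>a b. (x j ** N ** x (j - 1))$a$b = c * x (j + 1)$a$b"
      by (rule prim_mult_triple_dividend[OF rec[of k], folded j_def]) (rule that)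
    have X: "?X i \<ge> 1" if "i \<ge> 1" for i using one_le_infnorm[OF det[OF that]] .
    \<comment> \<open>The content \<open>c\<close> is bounded because the determinants are bounded and non-zero.\<close>
    have "det (x j ** N ** x (j - 1)) = c\<^sup>2 * det (x (j + 1))"
      by (simp only: det_2 c) (simp add: algebra_simps power2_eq_square)
    then have "c\<^sup>2 * det (x (j + 1)) = det (x j) * det N * det (x (j - 1))"
      by (simp add: det_mul)
    then have "(real_of_int c)\<^sup>2 * \<bar>real_of_int (det (x (j + 1)))\<bar>
        = \<bar>real_of_int (det (x j))\<bar> * \<bar>real_of_int (det N)\<bar> * \<bar>real_of_int (det (x (j - 1)))\<bar>"
      by (metis abs_mult abs_power2 of_int_mult of_int_power)
    also have "\<dots> \<le> C * \<bar>real_of_int (det N)\<bar> * C"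
      using detC[OF j(1)] detC[OF j(2)] C by (intro mult_mono) auto
    finally have c2: "(real_of_int c)\<^sup>2 * \<bar>real_of_int (det (x (j + 1)))\<bar> \<le> C\<^sup>2 * \<bar>real_of_int (det N)\<bar>"
      by (simp add: power2_eq_square mult_ac)
    have "det (x (j + 1)) \<noteq> 0" by (rule det) simp
    then have "1 \<le> \<bar>real_of_int (det (x (j + 1)))\<bar>" by linarith
    then have "(real_of_int c)\<^sup>2 * 1 \<le> (real_of_int c)\<^sup>2 * \<bar>real_of_int (det (x (j + 1)))\<bar>"
      by (intro mult_left_mono) auto
    moreover have "\<bar>real_of_int c\<bar> \<le> (real_of_int c)\<^sup>2"
    proof (cases "c = 0")
      case False
      then have "1 \<le> \<bar>real_of_int c\<bar>" by linarith
      then have "\<bar>real_of_int c\<bar> * 1 \<le> \<bar>real_of_int c\<bar> * \<bar>real_of_int c\<bar>" by (intro mult_left_mono) auto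
      then show ?thesis by (simp add: power2_eq_square)
    qed simp
    ultimately have cC: "\<bar>real_of_int c\<bar> \<le> C\<^sup>2 * \<bar>real_of_int (det N)\<bar>" using c2 by linarith
    let ?t = "defect \<xi> (x j) 1 * (N$1$1 + N$1$2 * \<xi>) + defect \<xi> (x j) 2 * (N$2$1 + N$2$2 * \<xi>)"
    let ?r = "defect \<xi> (x j) 1 * N$1$2 + defect \<xi> (x j) 2 * N$2$2"
    have id: "of_int (x (j - 1)$1$1) * ?t = c * defect \<xi> (x (j + 1)) 1 + defect \<xi> (x (j - 1)) 1 * ?r"
      by (rule defect_recurrence[OF c])
    have "\<bar>c * defect \<xi> (x (j + 1)) 1\<bar> * ?X j \<le> C\<^sup>2 * \<bar>real_of_int (det N)\<bar> * C\<^sup>2"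
    proof -
      have "\<bar>defect \<xi> (x (j + 1)) 1\<bar> * ?X j \<le> C / ?X (j + 1) * (C * ?X (j + 1))"
        using defect[of "j + 1" 1] step[OF j(1)] X[OF j(1)] X[of "j + 1"] C by (intro mult_mono) auto
      also have "\<dots> = C\<^sup>2" using X[of "j + 1"] by (simp add: power2_eq_square)
      finally have "\<bar>defect \<xi> (x (j + 1)) 1\<bar> * ?X j \<le> C\<^sup>2" .
      then have "\<bar>real_of_int c\<bar> * (\<bar>defect \<xi> (x (j + 1)) 1\<bar> * ?X j) \<le> C\<^sup>2 * \<bar>real_of_int (det N)\<bar> * C\<^sup>2"
        using cC X[OF j(1)] by - (rule mult_mono, auto)
      then show ?thesis by (simp add: abs_mult mult.assoc)
    qed
    moreover have "\<bar>defect \<xi> (x (j - 1)) 1 * ?r\<bar> * ?X j \<le> C\<^sup>2 * n"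
    proof -
      have "C / ?X (j - 1) \<le> C / 1" using C X[OF j(2)] by (intro divide_left_mono) auto
      then have d: "\<bar>defect \<xi> (x (j - 1)) 1\<bar> \<le> C" using defect[OF j(2), of 1] by simp
      have "\<bar>defect \<xi> (x j) a * real_of_int m\<bar> \<le> C / ?X j * \<bar>real_of_int m\<bar>" for a m
        unfolding abs_mult using defect[OF j(1), of a] by (intro mult_right_mono) auto
      from add_mono[OF this[of 1 "N$1$2"] this[of 2 "N$2$2"]]
      have "\<bar>?r\<bar> \<le> C / ?X j * n"
        unfolding n_def distrib_left by (rule order.trans[OF abs_triangle_ineq])
      then have "\<bar>?r\<bar> * ?X j \<le> C / ?X j * n * ?X j" using X[OF j(1)] by (intro mult_right_mono) auto
      also have "\<dots> = C * n" using X[OF j(1)] by simp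
      finally have "\<bar>defect \<xi> (x (j - 1)) 1\<bar> * (\<bar>?r\<bar> * ?X j) \<le> C * (C * n)"
        using d C X[OF j(1)] by - (rule mult_mono, auto)
      then show ?thesis by (simp add: abs_mult power2_eq_square mult.assoc)
    qed
    ultimately have "\<bar>of_int (x (j - 1)$1$1) * ?t\<bar> * ?X j \<le> E"
      unfolding id E_def
      using mult_right_mono[OF abs_triangle_ineq[of "c * defect \<xi> (x (j + 1)) 1" "defect \<xi> (x (j - 1)) 1 * ?r"],
          of "?X j"] X[OF j(1)]
      by (simp add: distrib_right)
    moreover have "\<bar>of_int (x (j - 1)$1$1) * ?t\<bar> * \<bar>real_of_int (x j$1$1)\<bar>
                 \<le> \<bar>of_int (x (j - 1)$1$1) * ?t\<bar> * ?X j"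
      by (intro mult_left_mono abs_entry_le_infnorm) auto
    ultimately show ?thesis
      unfolding j_def[symmetric] by (simp add: abs_mult mult_ac)
  qed
  have "filterlim (\<lambda>k. s k - 1) at_top sequentially"
    by (rule filterlim_compose[OF filterlim_minus_const_nat_at_top filterlim_subseq[OF s]])
  from filterlim_compose[OF filterlim_corner[OF x] this]
  have z: "filterlim (\<lambda>k. \<bar>real_of_int (x (s k - 1)$1$1)\<bar>) at_top sequentially" .
  have "(\<lambda>k. E / \<bar>real_of_int (x (s k - 1)$1$1)\<bar>) \<longlonglongrightarrow> 0"
    by (rule tendsto_divide_0[OF tendsto_const filterlim_at_top_imp_at_infinity[OF z]])
  moreover have "\<forall>\<^sub>F k in sequentially. norm (?T k) \<le> E / \<bar>real_of_int (x (s k - 1)$1$1)\<bar>"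
    using eventually_ge_at_top[of 2] filterlim_at_top_dense[THEN iffD1, OF z, rule_format, of 0]
  proof eventually_elim
    case (elim k)
    then show ?case using bound[of k] by (simp add: le_divide_eq)
  qed
  ultimately show ?thesis by (rule Lim_null_comparison[rotated])
qed


text \<open>The two limits solve the linear system formed by the orthogonality relation and by the
  determinant identity \<open>Y\<^sub>1\<^sub>1 (\<xi> \<delta>\<^sub>1 - \<delta>\<^sub>2) = D + \<delta>\<^sub>1\<^sup>2\<close>, where \<open>\<delta>\<^sub>1, \<delta>\<^sub>2\<close> are the defects of \<open>Y\<close>; the
  determinant of the system is \<open>-\<theta>\<close>.\<close>

lemma scaled_defect_limits:
  fixes \<xi> \<alpha> \<beta> \<theta> :: real and Y :: "nat \<Rightarrow> int^2^2"
  assumes \<theta>: "\<theta> = \<alpha> + \<beta> * \<xi>" "\<theta> \<noteq> 0"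
    and det: "\<And>k. det (Y k) = D" and sym: "\<And>k. Y k$2$1 = Y k$1$2"
    and lim0: "(\<lambda>k. defect \<xi> (Y k) 1) \<longlonglongrightarrow> 0"
    and orth: "(\<lambda>k. Y k$1$1 * (defect \<xi> (Y k) 1 * \<alpha> + defect \<xi> (Y k) 2 * \<beta>)) \<longlonglongrightarrow> 0"
  shows "(\<lambda>k. Y k$1$1 * defect \<xi> (Y k) 1) \<longlonglongrightarrow> D * \<beta> / \<theta>"
    and "(\<lambda>k. Y k$1$1 * defect \<xi> (Y k) 2) \<longlonglongrightarrow> - (D * \<alpha> / \<theta>)"
proof -
  let ?t = "\<lambda>k. Y k$1$1 * (defect \<xi> (Y k) 1 * \<alpha> + defect \<xi> (Y k) 2 * \<beta>)"
  let ?s = "\<lambda>k. D + (defect \<xi> (Y k) 1)\<^sup>2"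
  have s: "?s k = Y k$1$1 * (\<xi> * defect \<xi> (Y k) 1 - defect \<xi> (Y k) 2)" for k
    using det_symmetric_defect[OF sym[of k], of \<xi>] det[of k] by simp
  have "(\<lambda>k. (?t k + \<beta> * ?s k) / \<theta>) \<longlonglongrightarrow> (0 + \<beta> * (real_of_int D + 0\<^sup>2)) / \<theta>"
    by (intro tendsto_intros orth lim0 \<theta>)
  moreover have "(?t k + \<beta> * ?s k) / \<theta> = Y k$1$1 * defect \<xi> (Y k) 1" for k
    unfolding s using \<theta>(2) by (simp add: divide_eq_eq) (simp add: \<theta>(1) algebra_simps)
  ultimately show "(\<lambda>k. Y k$1$1 * defect \<xi> (Y k) 1) \<longlonglongrightarrow> D * \<beta> / \<theta>"
    by (simp add: mult.commute)
  have "(\<lambda>k. (\<xi> * ?t k - \<alpha> * ?s k) / \<theta>) \<longlonglongrightarrow> (\<xi> * 0 - \<alpha> * (real_of_int D + 0\<^sup>2)) / \<theta>"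
    by (intro tendsto_intros orth lim0 \<theta>)
  moreover have "(\<xi> * ?t k - \<alpha> * ?s k) / \<theta> = Y k$1$1 * defect \<xi> (Y k) 2" for k
    unfolding s using \<theta>(2) by (simp add: divide_eq_eq) (simp add: \<theta>(1) algebra_simps)
  ultimately show "(\<lambda>k. Y k$1$1 * defect \<xi> (Y k) 2) \<longlonglongrightarrow> - (D * \<alpha> / \<theta>)"
    by (simp add: mult.commute)
qed

section \<open>Approximating the values of the form\<close>

lemma irrational_linear_eq_0:
  fixes a b :: int and \<xi> :: real
  assumes "\<xi> \<notin> \<rat>" "a + b * \<xi> = 0"
  shows "a = 0 \<and> b = 0"
proof (rule ccontr)
  assume "\<not> ?thesis"
  with assms(2) have "b \<noteq> 0" by auto
  then have "\<xi> = of_int (- a) / of_int b" using assms(2) by (simp add: field_simps)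
  then have "\<xi> \<in> \<rat>" by (metis Rats_divide Rats_of_int)
  then show False using assms(1) by contradiction
qed

text \<open>The pair \<open>(p0, p1)\<close> is \<open>Y\<^sub>k Y\<^sub>i\<^sup>-\<^sup>1 (u1, u2)\<close> for a large \<open>i\<close> and a \<open>k\<close> that is large in terms of
  \<open>i\<close>. It is integral by the congruence assumption, since \<open>Y\<^sub>k Y\<^sub>i\<^sup>-\<^sup>1 = 1 + (Y\<^sub>k - Y\<^sub>i) Y\<^sub>i\<^sup>-\<^sup>1\<close>.\<close>

lemma form_values_attained:
  fixes \<alpha> \<beta> \<theta> \<xi> :: real and Y :: "nat \<Rightarrow> int^2^2" and u1 u2 D :: int
  assumes \<xi>: "\<xi> \<notin> \<rat>" and \<theta>: "\<theta> = \<alpha> + \<beta> * \<xi>" "\<theta> \<noteq> 0"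
    and D: "D \<noteq> 0" and det: "\<And>k. det (Y k) = D" and sym: "\<And>k. Y k$2$1 = Y k$1$2"
    and cong: "\<And>k l a b. D dvd Y k$a$b - Y l$a$b"
    and unbounded: "filterlim (\<lambda>k. \<bar>real_of_int (Y k$1$1)\<bar>) at_top sequentially"
    and lim1: "(\<lambda>k. Y k$1$1 * defect \<xi> (Y k) 1) \<longlonglongrightarrow> D * \<beta> / \<theta>"
    and lim2: "(\<lambda>k. Y k$1$1 * defect \<xi> (Y k) 2) \<longlonglongrightarrow> - (D * \<alpha> / \<theta>)"
    and u: "(u1, u2) \<noteq> (0, 0)" and \<epsilon>: "\<epsilon> > 0"
  shows "\<exists>p0 p1 :: int. R \<le> \<bar>real_of_int p0\<bar> \<and>
     \<bar>p0 * (p1 - \<xi> * p0)\<bar> \<le> \<bar>(u2 - \<xi> * u1) * (\<alpha> * u1 + \<beta> * u2)\<bar> / \<bar>\<theta>\<bar> + \<epsilon>"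
proof -
  let ?d = "\<lambda>k. defect \<xi> (Y k)"
  let ?G = "(u2 - \<xi> * u1) * (\<alpha> * u1 + \<beta> * u2)"
  have lim0: "(\<lambda>k. ?d k a) \<longlonglongrightarrow> 0" if "(\<lambda>k. Y k$1$1 * ?d k a) \<longlonglongrightarrow> L" for a L
  proof -
    have inf: "filterlim (\<lambda>k. real_of_int (Y k$1$1)) at_infinity sequentially"
      using filterlim_at_top_imp_at_infinity[OF unbounded]
      by (simp add: filterlim_at_infinity_conv_norm_at_top)
    have "(\<lambda>k. Y k$1$1 * ?d k a / Y k$1$1) \<longlonglongrightarrow> 0"
      by (rule tendsto_divide_0[OF that inf])
    moreover have "\<forall>\<^sub>F k in sequentially. Y k$1$1 * ?d k a / Y k$1$1 = ?d k a"
      using filterlim_at_top_dense[THEN iffD1, OF unbounded, rule_format, of 0]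
      by eventually_elim simp
    ultimately show ?thesis by (rule Lim_transform_eventually)
  qed
  note d1 = lim0[OF lim1] and d2 = lim0[OF lim2]
  \<comment> \<open>\<open>(W1 i, W2 i)\<close> is \<open>D Y\<^sub>i\<^sup>-\<^sup>1 (u1, u2)\<close>, and \<open>P i\<close> is the limit of \<open>p0 (p1 - \<xi> p0)\<close> as \<open>k\<close> tends to
    infinity with \<open>i\<close> fixed.\<close>
  define W1 where "W1 = (\<lambda>i. Y i$2$2 * u1 - Y i$1$2 * u2)"
  define W2 where "W2 = (\<lambda>i. Y i$1$1 * u2 - Y i$1$2 * u1)"
  define P where "P = (\<lambda>i. - ((W1 i + \<xi> * W2 i) * (\<beta> * W1 i - \<alpha> * W2 i) / (D * \<theta>)))"
  have W12: "Y i$1$1 * W1 i + Y i$1$2 * W2 i = D * u1"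
            "Y i$1$2 * W1 i + Y i$2$2 * W2 i = D * u2" for i
    using det[of i] sym[of i] by (auto simp: W1_def W2_def det_2 algebra_simps)
  have "P \<longlonglongrightarrow> ?G / \<theta>"
  proof -
    define e where "e = (\<lambda>i. \<beta> * ((- \<xi> * ?d i 1 - ?d i 2) * u1 + ?d i 1 * u2) - \<alpha> * ?d i 1 * u1)"
    \<comment> \<open>Only the products \<open>Y\<^sub>1\<^sub>1 \<delta>\<close>, whose limits are known, and terms tending to \<open>0\<close> remain.\<close>
    have P_eq: "P i = - ((- (Y i$1$1 * ?d i 2) * u1 + Y i$1$1 * ?d i 1 * u2) * (\<theta> * (\<xi> * u1 - u2))
        + (- ?d i 2 * u1 + ?d i 1 * u2) * e i) / (D * \<theta>)" for i
    proof -
      have e1: "W1 i + \<xi> * W2 i = - ?d i 2 * u1 + ?d i 1 * u2"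
        using sym[of i] by (simp add: W1_def W2_def defect_def algebra_simps)
      have e2: "\<beta> * W1 i - \<alpha> * W2 i = Y i$1$1 * \<theta> * (\<xi> * u1 - u2) + e i"
        using sym[of i] by (simp add: W1_def W2_def defect_def e_def \<theta>(1) algebra_simps)
      show ?thesis
        unfolding P_def e1 e2 minus_divide_left by (simp add: algebra_simps)
    qed
    have e: "e \<longlonglongrightarrow> \<beta> * ((- \<xi> * 0 - 0) * u1 + 0 * real_of_int u2) - \<alpha> * 0 * u1"
      unfolding e_def by (intro tendsto_intros d1 d2)
    let ?L = "- ((- (- (D * \<alpha> / \<theta>)) * u1 + D * \<beta> / \<theta> * u2) * (\<theta> * (\<xi> * u1 - u2))
        + (- 0 * real_of_int u1 + 0 * real_of_int u2) * (\<beta> * ((- \<xi> * 0 - 0) * u1 + 0 * real_of_int u2) - \<alpha> * 0 * u1)) / (D * \<theta>)"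
    have "P \<longlonglongrightarrow> ?L"
      unfolding P_eq using D \<theta>(2) by (intro tendsto_intros lim1 lim2 d1 d2 e) auto
    moreover have "?L = ?G / \<theta>"
      using D \<theta>(2) by (simp add: field_simps)
    ultimately show ?thesis by simp
  qed
  then have "(\<lambda>i. \<bar>P i\<bar>) \<longlonglongrightarrow> \<bar>?G / \<theta>\<bar>" by (rule tendsto_rabs)
  then have "\<forall>\<^sub>F i in sequentially. \<bar>P i\<bar> < \<bar>?G / \<theta>\<bar> + \<epsilon>"
    by (rule order_tendstoD) (use \<epsilon> in simp)
  then obtain i where i: "\<bar>P i\<bar> < \<bar>?G / \<theta>\<bar> + \<epsilon>"
    by (auto dest: eventually_happens)
  define w1 where "w1 = real_of_int (W1 i) / D"
  define w2 where "w2 = real_of_int (W2 i) / D"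
  let ?\<omega> = "w1 + \<xi> * w2"
  have \<omega>: "?\<omega> \<noteq> 0"
  proof
    assume "?\<omega> = 0"
    then have "W1 i + W2 i * \<xi> = 0" using D by (simp add: w1_def w2_def field_simps)
    then have "W1 i = 0" "W2 i = 0" using irrational_linear_eq_0[OF \<xi>] by auto
    then show False using W12[of i] D u by simp
  qed
  \<comment> \<open>With \<open>p = Y\<^sub>k (w1, w2)\<close>, these are \<open>p0\<close> and \<open>p1 - \<xi> p0\<close>.\<close>
  define q0 where "q0 = (\<lambda>k. Y k$1$1 * ?\<omega> - ?d k 1 * w2)"
  define q1 where "q1 = (\<lambda>k. - (?d k 1 * w1 + ?d k 2 * w2))"
  have "(\<lambda>k. - ((Y k$1$1 * ?d k 1) * w1 + (Y k$1$1 * ?d k 2) * w2) * ?\<omega> - ?d k 1 * w2 * q1 k)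
     \<longlonglongrightarrow> - (D * \<beta> / \<theta> * w1 + - (D * \<alpha> / \<theta>) * w2) * ?\<omega> - 0 * w2 * - (0 * w1 + 0 * w2)"
    unfolding q1_def by (intro tendsto_intros lim1 lim2 d1 d2)
  moreover have "- (D * \<beta> / \<theta> * w1 + - (D * \<alpha> / \<theta>) * w2) * ?\<omega> - 0 * w2 * - (0 * w1 + 0 * w2) = P i"
    unfolding P_def w1_def w2_def using D \<theta>(2) by (simp add: field_simps)
  moreover have "- ((Y k$1$1 * ?d k 1) * w1 + (Y k$1$1 * ?d k 2) * w2) * ?\<omega> - ?d k 1 * w2 * q1 k
      = q0 k * q1 k" for k
    by (simp add: q0_def q1_def algebra_simps)
  ultimately have "(\<lambda>k. q0 k * q1 k) \<longlonglongrightarrow> P i" by simp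
  then have "(\<lambda>k. \<bar>q0 k * q1 k\<bar>) \<longlonglongrightarrow> \<bar>P i\<bar>" by (rule tendsto_rabs)
  then have ev1: "\<forall>\<^sub>F k in sequentially. \<bar>q0 k * q1 k\<bar> < \<bar>?G / \<theta>\<bar> + \<epsilon>"
    using i by (rule order_tendstoD)
  have ev2: "\<forall>\<^sub>F k in sequentially. \<bar>?d k 1 * w2\<bar> < 1"
    by (rule order_tendstoD(2)[of _ "\<bar>0 * w2\<bar>"]) (intro tendsto_intros d1, simp)
  have ev3: "\<forall>\<^sub>F k in sequentially. (R + 1) / \<bar>?\<omega>\<bar> \<le> \<bar>real_of_int (Y k$1$1)\<bar>"
    using unbounded by (simp add: filterlim_at_top)
  obtain k where k: "\<bar>q0 k * q1 k\<bar> < \<bar>?G / \<theta>\<bar> + \<epsilon>" "\<bar>?d k 1 * w2\<bar> < 1"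
      "(R + 1) / \<bar>?\<omega>\<bar> \<le> \<bar>real_of_int (Y k$1$1)\<bar>"
    using eventually_happens[OF eventually_conj[OF ev1 eventually_conj[OF ev2 ev3]]] by auto
  have "D dvd Y k$1$1 * W1 i + Y k$1$2 * W2 i"
  proof -
    have "Y k$1$1 * W1 i + Y k$1$2 * W2 i
        = (Y k$1$1 - Y i$1$1) * W1 i + (Y k$1$2 - Y i$1$2) * W2 i + D * u1"
      unfolding W12(1)[of i, symmetric] by (simp add: algebra_simps)
    then show ?thesis using cong[of k _ _ i] by simp
  qed
  then obtain p0 where p0: "Y k$1$1 * W1 i + Y k$1$2 * W2 i = D * p0" by (auto simp: dvd_def)
  have "D dvd Y k$1$2 * W1 i + Y k$2$2 * W2 i"
  proof -
    have "Y k$1$2 * W1 i + Y k$2$2 * W2 i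
        = (Y k$1$2 - Y i$1$2) * W1 i + (Y k$2$2 - Y i$2$2) * W2 i + D * u2"
      unfolding W12(2)[of i, symmetric] by (simp add: algebra_simps)
    then show ?thesis using cong[of k _ _ i] by simp
  qed
  then obtain p1 where p1: "Y k$1$2 * W1 i + Y k$2$2 * W2 i = D * p1" by (auto simp: dvd_def)
  have p0_eq: "real_of_int p0 = Y k$1$1 * w1 + Y k$1$2 * w2"
    using arg_cong[OF p0, of real_of_int] D by (simp add: w1_def w2_def field_simps)
  have p1_eq: "real_of_int p1 = Y k$1$2 * w1 + Y k$2$2 * w2"
    using arg_cong[OF p1, of real_of_int] D by (simp add: w1_def w2_def field_simps)
  have q0: "real_of_int p0 = q0 k"
    unfolding p0_eq q0_def using sym[of k] by (simp add: defect_def algebra_simps)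
  have q1: "p1 - \<xi> * p0 = q1 k"
    unfolding p0_eq p1_eq q1_def using sym[of k] by (simp add: defect_def algebra_simps)
  have "R + 1 \<le> \<bar>Y k$1$1 * ?\<omega>\<bar>"
    using k(3) \<omega> by (simp add: abs_mult divide_le_eq)
  also have "\<dots> \<le> \<bar>q0 k\<bar> + \<bar>?d k 1 * w2\<bar>"
    unfolding q0_def by linarith
  finally have "R \<le> \<bar>q0 k\<bar>" using k(2) by linarith
  moreover have "\<bar>q0 k * q1 k\<bar> \<le> \<bar>?G\<bar> / \<bar>\<theta>\<bar> + \<epsilon>"
    using k(1) unfolding abs_divide by (rule less_imp_le)
  ultimately show ?thesis using q0 q1 by metis
qed


section \<open>Matrices in a common residue class\<close>

lemma residue_class_subsequence:
  fixes x :: "nat \<Rightarrow> int^2^2" and J :: "nat set"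
  assumes "infinite J" and bound: "\<And>i. i \<in> J \<Longrightarrow> \<bar>real_of_int (det (x i))\<bar> \<le> C"
    and nz: "\<And>i. i \<in> J \<Longrightarrow> det (x i) \<noteq> 0"
  shows "\<exists>(s :: nat \<Rightarrow> nat) D. strict_mono s \<and> (\<forall>k. s k \<in> J) \<and> (\<forall>k. det (x (s k)) = D) \<and>
    (\<forall>k l a b. D dvd x (s k)$a$b - x (s l)$a$b)"
proof -
  define B where "B = {- \<lfloor>C\<rfloor>..\<lfloor>C\<rfloor>}"
  define f where "f = (\<lambda>i. (det (x i), x i$1$1 mod det (x i), x i$1$2 mod det (x i),
                             x i$2$1 mod det (x i), x i$2$2 mod det (x i)))"
  have "f i \<in> B \<times> B \<times> B \<times> B \<times> B" if "i \<in> J" for i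
  proof -
    have d: "\<bar>det (x i)\<bar> \<le> \<lfloor>C\<rfloor>"
      using bound[OF that] by (simp add: le_floor_iff)
    have "y mod det (x i) \<in> B" for y
      using d abs_mod_less[OF nz[OF that], of y] by (auto simp: B_def)
    then show ?thesis using d by (auto simp: f_def B_def)
  qed
  then have "f ` J \<subseteq> B \<times> B \<times> B \<times> B \<times> B" by blast
  then have "finite (f ` J)" by (rule finite_subset) (auto simp: B_def)
  from pigeonhole_infinite[OF \<open>infinite J\<close> this] obtain i0 where "infinite {i \<in> J. f i = f i0}"
    by blast
  from infinite_enumerate[OF this] obtain s :: "nat \<Rightarrow> nat"
    where s: "strict_mono s" "\<And>k. s k \<in> J" "\<And>k. f (s k) = f i0"
    by blast
  show ?thesis
  proof (intro exI[of _ s] exI[of _ "det (x i0)"] conjI allI s)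
    show det: "det (x (s k)) = det (x i0)" for k
      using s(3)[of k] by (simp add: f_def)
    fix k l and a b :: 2
    have "x (s k)$a$b mod det (x i0) = x i0$a$b mod det (x i0)" for k
      using s(3)[of k] exhaust_2[of a] exhaust_2[of b] by (auto simp: f_def)
    then show "det (x i0) dvd x (s k)$a$b - x (s l)$a$b"
      by (simp add: mod_eq_dvd_iff[symmetric])
  qed
qed

section \<open>Bounds for the Lagrange constant\<close>

lemma lagrange_const_leI:
  fixes \<xi> B :: real
  assumes "\<And>R \<epsilon>. \<epsilon> > 0 \<Longrightarrow> \<exists>p0 p1 :: int. R \<le> \<bar>real_of_int p0\<bar> \<and> \<bar>p0 * (p1 - \<xi> * p0)\<bar> \<le> B + \<epsilon>"
  shows "lagrange_const \<xi> \<le> ereal B"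
proof (rule ccontr)
  assume "\<not> ?thesis"
  then obtain r where r: "ereal B < ereal r" "ereal r < lagrange_const \<xi>"
    using ereal_dense2 by (metis not_le)
  then have "\<forall>\<^sub>F q in sequentially. ereal r < ereal (real q * infdist (real q * \<xi>) \<int>)"
    unfolding lagrange_const_def by (intro less_LiminfD)
  then obtain R where R: "\<And>q. q \<ge> R \<Longrightarrow> r < real q * infdist (real q * \<xi>) \<int>"
    by (auto simp: eventually_sequentially)
  from r have "r - B > 0" by simp
  from assms[OF this] obtain p0 p1 :: int
    where p: "real R \<le> \<bar>real_of_int p0\<bar>" "\<bar>p0 * (p1 - \<xi> * p0)\<bar> \<le> B + (r - B)" by blast
  define q where "q = nat \<bar>p0\<bar>"
  have q: "real q = \<bar>real_of_int p0\<bar>" by (simp add: q_def)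
  have "real q * infdist (real q * \<xi>) \<int> \<le> real q * dist (real q * \<xi>) (of_int (sgn p0 * p1))"
    by (intro mult_left_mono infdist_le) auto
  also have "real q * dist (real q * \<xi>) (of_int (sgn p0 * p1)) = \<bar>p0 * (p1 - \<xi> * p0)\<bar>"
  proof (cases "p0 = 0")
    case False
    have "real q * \<xi> - of_int (sgn p0 * p1) = - (sgn p0 * (p1 - \<xi> * p0))"
      using False by (cases "p0 > 0") (simp_all add: q algebra_simps)
    moreover have "\<bar>real_of_int (sgn p0)\<bar> = 1" using False by (simp add: sgn_if)
    ultimately have "dist (real q * \<xi>) (of_int (sgn p0 * p1)) = \<bar>p1 - \<xi> * p0\<bar>"
      unfolding dist_real_def by (simp only: abs_minus_cancel abs_mult mult_1)
    then show ?thesis by (simp add: q abs_mult)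
  qed (simp add: q)
  finally have "real q * infdist (real q * \<xi>) \<int> \<le> \<bar>p0 * (p1 - \<xi> * p0)\<bar>" .
  moreover have "R \<le> q" using p(1) q by simp
  ultimately show False using R[of q] p(2) by simp
qed

text \<open>Here \<open>m\<close> is a lower bound for the absolute value of the form \<open>(t - \<xi> u) (\<alpha> u + \<beta> t)\<close> at the integer
  points with \<open>u \<noteq> 0\<close>. At the point
  \<open>(q, p)\<close> with \<open>p\<close> nearest to \<open>q \<xi>\<close> and \<open>l = p - \<xi> q\<close>, the form equals \<open>\<theta> q l + \<beta> l\<^sup>2\<close>. Unless \<open>q \<bar>l\<bar>\<close>
  is already at least the claimed bound \<open>m / \<bar>\<theta>\<bar>\<close>, \<open>l\<close> is \<open>O(1 / q)\<close>, so that the second term is negligible.\<close>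

lemma lagrange_const_geI:
  fixes \<alpha> \<beta> \<theta> \<xi> m :: real
  assumes \<theta>: "\<theta> = \<alpha> + \<beta> * \<xi>" "\<theta> \<noteq> 0" and "m \<ge> 0"
    and m: "\<And>(q :: int) (p :: int). q \<noteq> (0 :: int) \<Longrightarrow> m \<le> \<bar>(p - \<xi> * q) * (\<alpha> * q + \<beta> * p)\<bar>"
  shows "ereal (m / \<bar>\<theta>\<bar>) \<le> lagrange_const \<xi>"
proof -
  define n where "n = m / \<bar>\<theta>\<bar>"
  define K where "K = \<bar>\<beta>\<bar> * n\<^sup>2 / \<bar>\<theta>\<bar>"
  let ?f = "\<lambda>q::nat. real q * infdist (real q * \<xi>) \<int>"
  have n: "n \<ge> 0" "m = n * \<bar>\<theta>\<bar>" using assms by (auto simp: n_def)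
  have K: "K \<ge> 0" by (simp add: K_def)
  have bound: "n - K / (real q)\<^sup>2 \<le> ?f q" if q: "q \<ge> 1" for q
  proof (cases "n \<le> ?f q")
    case True
    have "0 \<le> K / (real q)\<^sup>2" using K by simp
    then show ?thesis using True by linarith
  next
    case False
    obtain y where y: "y \<in> \<int>" "infdist (real q * \<xi>) \<int> = dist (real q * \<xi>) y"
      using infdist_attains_inf[of "\<int> :: real set" "real q * \<xi>"] closed_Ints Ints_0 by blast
    then obtain p :: int where p: "y = of_int p" by (elim Ints_cases)
    define l where "l = real_of_int p - \<xi> * q"
    have f: "?f q = real q * \<bar>l\<bar>"
      unfolding y(2) by (simp add: p l_def dist_real_def abs_minus_commute mult.commute)
    have "m \<le> \<bar>l * (\<alpha> * q + \<beta> * p)\<bar>"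
      using m[of "int q" p] q by (simp add: l_def)
    also have "l * (\<alpha> * q + \<beta> * p) = l * (q * \<theta>) + \<beta> * l\<^sup>2"
      by (simp add: l_def \<theta>(1) power2_eq_square algebra_simps)
    also have "\<bar>\<dots>\<bar> \<le> ?f q * \<bar>\<theta>\<bar> + \<bar>\<beta>\<bar> * l\<^sup>2"
      unfolding f using abs_triangle_ineq[of "l * (q * \<theta>)" "\<beta> * l\<^sup>2"] by (simp add: abs_mult mult_ac)
    also have "\<bar>\<beta>\<bar> * l\<^sup>2 \<le> \<bar>\<beta>\<bar> * (n / q)\<^sup>2"
    proof (rule mult_left_mono)
      have "\<bar>l\<bar> \<le> n / q" using False f q by (simp add: le_divide_eq mult.commute)
      then show "l\<^sup>2 \<le> (n / q)\<^sup>2" by (rule power2_le_iff_abs_le[THEN iffD2, rotated]) (use n in simp)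
    qed simp
    finally have "n * \<bar>\<theta>\<bar> - \<bar>\<beta>\<bar> * (n / q)\<^sup>2 \<le> ?f q * \<bar>\<theta>\<bar>"
      using n(2) by linarith
    then have "(n * \<bar>\<theta>\<bar> - \<bar>\<beta>\<bar> * (n / q)\<^sup>2) / \<bar>\<theta>\<bar> \<le> ?f q"
      using \<theta>(2) by (simp add: divide_le_eq)
    moreover have "(n * \<bar>\<theta>\<bar> - \<bar>\<beta>\<bar> * (n / q)\<^sup>2) / \<bar>\<theta>\<bar> = n - K / (real q)\<^sup>2"
      using \<theta>(2) by (simp add: K_def diff_divide_distrib power_divide)
    ultimately show ?thesis by simp
  qed
  have "filterlim (\<lambda>q. (real q)\<^sup>2) at_top sequentially"
    by (rule filterlim_pow_at_top[OF _ filterlim_real_sequentially]) simp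
  then have "(\<lambda>q. K / (real q)\<^sup>2) \<longlonglongrightarrow> 0"
    by (intro tendsto_divide_0[OF tendsto_const] filterlim_at_top_imp_at_infinity)
  from tendsto_diff[OF tendsto_const this, of n]
  have "(\<lambda>q. ereal (n - K / (real q)\<^sup>2)) \<longlonglongrightarrow> ereal n" by simp
  then have "ereal n = liminf (\<lambda>q. ereal (n - K / (real q)\<^sup>2))"
    by (rule lim_imp_Liminf[OF sequentially_bot, symmetric])
  also have "\<dots> \<le> lagrange_const \<xi>"
    unfolding lagrange_const_def
    by (rule Liminf_mono) (use bound in \<open>auto simp: eventually_sequentially\<close>)
  finally show ?thesis by (simp add: n_def)
qed

section \<open>The Lagrange constant in terms of the associated forms\<close>

text \<open>Both associated forms are covered: the second one is the first one for the transpose of \<open>M\<close>.\<close>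

lemma lagrange_const_eq_form:
  fixes \<xi> :: real and N :: "int^2^2" and J :: "nat set"
  assumes ext: "extremal \<xi>" and x: "approximating_sequence \<xi> x"
    and N: "det N \<noteq> 0" "transpose N \<noteq> - N" and "infinite J"
    and rec: "\<And>j. j \<in> J \<Longrightarrow> j \<ge> 1 \<and> x (j + 1) \<in> {x j \<star> N \<star> x (j - 1), - (x j \<star> N \<star> x (j - 1))}"
  shows "lagrange_const \<xi> = ereal (bqf_min (assoc_form1 \<xi> N) / sqrt (bqf_disc (assoc_form1 \<xi> N)))"
proof -
  define \<alpha> where "\<alpha> = N$1$1 + N$1$2 * \<xi>"
  define \<beta> where "\<beta> = N$2$1 + N$2$2 * \<xi>"
  define \<theta> where "\<theta> = \<alpha> + \<beta> * \<xi>"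
  let ?F = "assoc_form1 \<xi> N" and ?m = "bqf_min (assoc_form1 \<xi> N)"
  from ext have irr: "\<xi> \<notin> \<rat>" and nq: "\<not> quadratic_irrational \<xi>"
    by (auto simp: extremal_def)
  have \<theta>: "\<theta> \<noteq> 0"
  proof
    assume "\<theta> = 0"
    then have 0: "N$2$2 * \<xi>\<^sup>2 + (N$1$2 + N$2$1) * \<xi> + N$1$1 = 0"
      by (simp add: \<theta>_def \<alpha>_def \<beta>_def algebra_simps power2_eq_square)
    have d: "N$2$2 = 0"
    proof (rule ccontr)
      assume "N$2$2 \<noteq> 0"
      then have "quadratic_irrational \<xi>"
        unfolding quadratic_irrational_def using irr 0
        by (intro conjI bexI[of _ "real_of_int (N$2$2)"] bexI[of _ "real_of_int (N$1$2 + N$2$1)"]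
            bexI[of _ "real_of_int (N$1$1)"]) auto
      then show False using nq by contradiction
    qed
    have "N$1$1 = 0 \<and> N$1$2 + N$2$1 = 0"
      by (rule irrational_linear_eq_0[OF irr]) (use 0 d in simp)
    then have "transpose N = - N"
      using d by (simp add: transpose_def vec_eq_iff forall_2 add_eq_0_iff)
    then show False using N(2) by contradiction
  qed
  have \<beta>: "\<beta> \<noteq> 0"
    using irrational_linear_eq_0[OF irr, of "N$2$1" "N$2$2"] N(1) by (auto simp: \<beta>_def det_2)
  have F: "?F = bqf_factored \<beta> \<xi> (- \<alpha> / \<beta>)"
    by (simp add: assoc_form1_def conj1_def \<alpha>_def \<beta>_def)
  have eval: "bqf_eval ?F u t = (t - \<xi> * u) * (\<alpha> * u + \<beta> * t)" for u t
    unfolding F bqf_eval_factored using \<beta> by (simp add: field_simps)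
  have "bqf_disc ?F = \<theta>\<^sup>2"
    unfolding F bqf_factored_def using \<beta> by (simp add: \<theta>_def field_simps power2_eq_square)
  then have disc: "sqrt (bqf_disc ?F) = \<bar>\<theta>\<bar>" by simp
  let ?S = "{\<bar>bqf_eval ?F (of_int x) (of_int y)\<bar> | x y :: int. (x, y) \<noteq> (0, 0)}"
  have S: "?S \<noteq> {}" "bdd_below ?S"
    by (auto intro!: exI[of _ 1] bdd_belowI[of _ 0])
  obtain C where det: "\<And>i. i \<ge> 1 \<Longrightarrow> det (x i) \<noteq> 0"
    and sym: "\<And>i. i \<ge> 1 \<Longrightarrow> transpose (x i) = x i"
    and detC: "\<And>i. i \<ge> 1 \<Longrightarrow> \<bar>real_of_int (det (x i))\<bar> \<le> C"
    by (rule approximating_sequence_bounds[OF x]) blast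
  have J1: "j \<ge> 1" if "j \<in> J" for j using rec[OF that] by blast
  have "\<exists>(s :: nat \<Rightarrow> nat) D. strict_mono s \<and> (\<forall>k. s k \<in> J) \<and> (\<forall>k. det (x (s k)) = D) \<and>
    (\<forall>k l a b. D dvd x (s k)$a$b - x (s l)$a$b)"
    by (rule residue_class_subsequence[where C = C, OF \<open>infinite J\<close>]) (intro detC det J1; assumption)+
  then obtain s :: "nat \<Rightarrow> nat" and D where s: "strict_mono s" "\<And>k. s k \<in> J" "\<And>k. det (x (s k)) = D"
      "\<And>k l a b. D dvd x (s k)$a$b - x (s l)$a$b"
    by blast
  have D: "D \<noteq> 0" using det[OF J1[OF s(2)]] s(3) by simp
  have sym': "x (s k)$2$1 = x (s k)$1$2" for k
    using sym[OF J1[OF s(2)[of k]]] by (simp add: transpose_def vec_eq_iff)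
  have unbounded: "filterlim (\<lambda>k. \<bar>real_of_int (x (s k)$1$1)\<bar>) at_top sequentially"
    by (rule filterlim_compose[OF filterlim_corner[OF x] filterlim_subseq[OF s(1)]])
  have orth: "(\<lambda>k. x (s k)$1$1 * (defect \<xi> (x (s k)) 1 * \<alpha> + defect \<xi> (x (s k)) 2 * \<beta>)) \<longlonglongrightarrow> 0"
    unfolding \<alpha>_def \<beta>_def
    by (rule defect_orthogonality[OF x s(1)]) (use rec[OF s(2)] in blast)
  have lim0: "(\<lambda>k. defect \<xi> (x (s k)) 1) \<longlonglongrightarrow> 0"
    by (rule filterlim_compose[OF defect_tendsto_0[OF x] filterlim_subseq[OF s(1)]])
  note lims = scaled_defect_limits[where Y = "\<lambda>k. x (s k)", OF \<theta>_def \<theta> s(3) sym' lim0 orth]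
  have upper: "lagrange_const \<xi> \<le> ereal (\<bar>bqf_eval ?F (of_int u) (of_int t)\<bar> / \<bar>\<theta>\<bar>)"
    if "(u, t) \<noteq> (0, 0)" for u t
    unfolding eval
    by (intro lagrange_const_leI form_values_attained[where Y = "\<lambda>k. x (s k)" and D = D]
        irr \<theta>_def \<theta> D s sym' unbounded lims that)
  show ?thesis
  proof (rule antisym)
    show "lagrange_const \<xi> \<le> ereal (?m / sqrt (bqf_disc ?F))"
      unfolding disc
    proof (rule ccontr)
      assume "\<not> lagrange_const \<xi> \<le> ereal (?m / \<bar>\<theta>\<bar>)"
      then obtain r where r: "ereal (?m / \<bar>\<theta>\<bar>) < ereal r" "ereal r < lagrange_const \<xi>"
        using ereal_dense2 by (metis not_le)
      then have "?m < r * \<bar>\<theta>\<bar>" using \<theta> by (simp add: divide_less_eq)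
      then obtain u t where ut: "(u, t) \<noteq> (0, 0)"
          "\<bar>bqf_eval ?F (of_int u) (of_int t)\<bar> < r * \<bar>\<theta>\<bar>"
        unfolding bqf_min_def using cInf_lessD[OF S(1)] by blast
      then have "ereal (\<bar>bqf_eval ?F (of_int u) (of_int t)\<bar> / \<bar>\<theta>\<bar>) < ereal r"
        using \<theta> by (simp add: divide_less_eq)
      then show False
        using upper[OF ut(1)] r(2) by (metis order.strict_trans1 order.strict_trans less_irrefl)
    qed
    show "ereal (?m / sqrt (bqf_disc ?F)) \<le> lagrange_const \<xi>"
      unfolding disc
    proof (rule lagrange_const_geI[OF \<theta>_def \<theta>])
      show "0 \<le> ?m" unfolding bqf_min_def by (rule cInf_greatest[OF S(1)]) auto
      fix q p :: int assume "q \<noteq> 0"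
      then show "?m \<le> \<bar>(p - \<xi> * q) * (\<alpha> * q + \<beta> * p)\<bar>"
        unfolding bqf_min_def eval[symmetric] by (intro cInf_lower[OF _ S(2)]) auto
    qed
  qed
qed

theorem theorem5p8:
  fixes \<xi> :: real and M :: "int^2^2"
  assumes "extremal \<xi>"
    and "associated_matrix \<xi> M"
  shows "lagrange_const \<xi> = ereal (bqf_min (assoc_form1 \<xi> M) / sqrt (bqf_disc (assoc_form1 \<xi> M)))
       \<and> lagrange_const \<xi> = ereal (bqf_min (assoc_form2 \<xi> M) / sqrt (bqf_disc (assoc_form2 \<xi> M)))"
proof -
  from assms(2) obtain x where x: "approximating_sequence \<xi> x"
    and M: "det M \<noteq> 0" "transpose M \<noteq> - M"
    and "\<forall>\<^sub>F i in sequentially.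
           (odd i \<longrightarrow> x (i + 2) \<in> {x (i + 1) \<star> M \<star> x i, - (x (i + 1) \<star> M \<star> x i)}) \<and>
           (even i \<longrightarrow> x (i + 2) \<in> {x (i + 1) \<star> transpose M \<star> x i,
                                      - (x (i + 1) \<star> transpose M \<star> x i)})"
    by (auto simp: associated_matrix_def prim_mats_def)
  then obtain n where n: "\<And>i. i \<ge> n \<Longrightarrow>
           (odd i \<longrightarrow> x (i + 2) \<in> {x (i + 1) \<star> M \<star> x i, - (x (i + 1) \<star> M \<star> x i)}) \<and>
           (even i \<longrightarrow> x (i + 2) \<in> {x (i + 1) \<star> transpose M \<star> x i,
                                      - (x (i + 1) \<star> transpose M \<star> x i)})"
    by (auto simp: eventually_sequentially)
  \<comment> \<open>With \<open>j = i + 1\<close>, the recurrence involves \<open>M\<close> for even \<open>j\<close> and its transpose for odd \<open>j\<close>.\<close>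
  have inf: "infinite {j. j > n \<and> even j}" "infinite {j. j > n \<and> odd j}"
    unfolding infinite_nat_iff_unbounded_le
  proof (safe)
    fix m
    show "\<exists>j\<ge>m. j \<in> {j. j > n \<and> even j}" by (intro exI[of _ "2 * (m + n + 1)"]) auto
    show "\<exists>j\<ge>m. j \<in> {j. j > n \<and> odd j}" by (intro exI[of _ "2 * (m + n) + 1"]) auto
  qed
  have M': "det (transpose M) \<noteq> 0" "transpose (transpose M) \<noteq> - transpose M"
    using M by (simp add: det_transpose) (metis M(2) equation_minus_iff transpose_transpose)
  have form: "assoc_form2 \<xi> M = assoc_form1 \<xi> (transpose M)"
    by (simp add: assoc_form1_def assoc_form2_def conj1_def conj2_def transpose_def)
  show ?thesis
    unfolding form
  proof (rule conjI)
    show "lagrange_const \<xi> = ereal (bqf_min (assoc_form1 \<xi> M) / sqrt (bqf_disc (assoc_form1 \<xi> M)))"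
    proof (rule lagrange_const_eq_form[OF assms(1) x M inf(1)])
      fix j assume "j \<in> {j. j > n \<and> even j}"
      then show "j \<ge> 1 \<and> x (j + 1) \<in> {x j \<star> M \<star> x (j - 1), - (x j \<star> M \<star> x (j - 1))}"
        using n[of "j - 1"] by auto
    qed
    show "lagrange_const \<xi> = ereal (bqf_min (assoc_form1 \<xi> (transpose M))
                                      / sqrt (bqf_disc (assoc_form1 \<xi> (transpose M))))"
    proof (rule lagrange_const_eq_form[OF assms(1) x M' inf(2)])
      fix j assume "j \<in> {j. j > n \<and> odd j}"
      then show "j \<ge> 1 \<and> x (j + 1) \<in> {x j \<star> transpose M \<star> x (j - 1), - (x j \<star> transpose M \<star> x (j - 1))}"
        using n[of "j - 1"] by auto
    qed
  qed
qed

end
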